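(* Let $G$ be a finite group, let $\Phi_1$ be an $\alpha_1$-representation of $\mathcal{L}(G)$ on a finite-dimensional complex vector space, and let $\alpha_2$ be a 2-cocycle cohomologous to $\alpha_1$. Then there exists an $\alpha_2$-representation $\Phi_2$ of $\mathcal{L}(G)$ which is projectively equivalent to $\Phi_1$.
   Context: For a finite group $G$, the Plesken Lie algebra $\mathcal{L}(G)$ over $\mathbb{C}$ is the linear span of the elements $\hat g = g - g^{-1}$ ($g\in G$) in the group algebra $\mathbb{C}[G]$, with Lie bracket the commutator $[x,y]=xy-yx$. Let $V$ be a finite-dimensional complex vector space and $\alpha:\mathcal{L}(G)\times\mathcal{L}(G)\to\mathbb{C}$ a bilinear map. An $\alpha$-representation of $\mathcal{L}(G)$ on $V$ is a linear map $\Phi:\mathcal{L}(G)\to\mathfrak{gl}(V)$ such that $[\Phi(x),\Phi(y)]=\alpha(x,y)I_V+\Phi([x,y])$ for all $x,y\in\mathcal{L}(G)$. A 2-cocycle is a bilinear map $\alpha:\mathcal{L}(G)\times\mathcal{L}(G)\to\mathbb{C}$ with $\alpha([x,y],z)+\alpha([y,z],x)+\alpha([z,x],y)=0$ for all $x,y,z\in\mathcal{L}(G)$. Two such maps $\alpha_1,\alpha_2$ are cohomologous if there exists a linear map $\sigma:\mathcal{L}(G)\to\mathbb{C}$ such that $\alpha_2(x,y)-\alpha_1(x,y)=-\sigma([x,y])$ for all $x,y\in\mathcal{L}(G)$. An $\alpha_1$-representation $\Phi_1$ on $V$ and an $\alpha_2$-representation $\Phi_2$ on $W$ are projectively equivalent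 if there exist a linear isomorphism $f:V\to W$ and a linear map $\delta:\mathcal{L}(G)\to\mathbb{C}$ such that $\Phi_2(x)=f\circ\Phi_1(x)\circ f^{-1}+\delta(x)I_W$ for all $x\in\mathcal{L}(G)$. *)

theory Defs
  imports Complex_Main "HOL-Algebra.Group" "HOL-Library.Function_Algebras"
begin

text \<open>
  The group algebra of a finite group \<open>G\<close> is the space of functions \<open>'a \<Rightarrow> complex\<close> vanishing
  outside \<open>carrier G\<close>. Its additive structure is the pointwise one of \<open>Function_Algebras\<close>; its
  product is the convolution \<open>ga_mult\<close>, not the pointwise product.
\<close>

definition fun_scale :: "(complex \<Rightarrow> 'c \<Rightarrow> 'c) \<Rightarrow> complex \<Rightarrow> ('b \<Rightarrow> 'c) \<Rightarrow> 'b \<Rightarrow> 'c" where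
  "fun_scale s c f = (\<lambda>b. s c (f b))"

abbreviation ga_scale :: "complex \<Rightarrow> ('a \<Rightarrow> complex) \<Rightarrow> 'a \<Rightarrow> complex" where
  "ga_scale \<equiv> fun_scale (*)"

lemma vector_space_fun_scale:
  assumes "vector_space s"
  shows "vector_space (fun_scale s)"
proof -
  interpret vector_space s by fact
  show ?thesis
    by unfold_locales
      (auto simp: fun_scale_def fun_eq_iff scale_right_distrib scale_left_distrib)
qed

definition ga_basis :: "'a \<Rightarrow> 'a \<Rightarrow> complex" where
  "ga_basis g = (\<lambda>h. of_bool (h = g))"

definition ga_mult ::
  "('a, 'b) monoid_scheme \<Rightarrow> ('a \<Rightarrow> complex) \<Rightarrow> ('a \<Rightarrow> complex) \<Rightarrow> 'a \<Rightarrow> complex" where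
  "ga_mult G x y = (\<lambda>g. \<Sum>(h, k)\<in>{(h, k). h \<in> carrier G \<and> k \<in> carrier G \<and> h \<otimes>\<^bsub>G\<^esub> k = g}. x h * y k)"

definition lie_bracket ::
  "('a, 'b) monoid_scheme \<Rightarrow> ('a \<Rightarrow> complex) \<Rightarrow> ('a \<Rightarrow> complex) \<Rightarrow> 'a \<Rightarrow> complex" where
  "lie_bracket G x y = ga_mult G x y - ga_mult G y x"

definition plesken :: "('a, 'b) monoid_scheme \<Rightarrow> ('a \<Rightarrow> complex) set" where
  "plesken G = module.span ga_scale ((\<lambda>g. ga_basis g - ga_basis (inv\<^bsub>G\<^esub> g)) ` carrier G)"

text \<open>
  Maps on the Plesken Lie algebra are total functions on \<open>'a \<Rightarrow> complex\<close> whose values outside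
  \<open>plesken G\<close> are irrelevant, so linearity is relativised to a subspace \<open>S\<close> of the source.
\<close>

definition linear_on_subspace ::
  "'b::ab_group_add set \<Rightarrow> (complex \<Rightarrow> 'b \<Rightarrow> 'b) \<Rightarrow> (complex \<Rightarrow> 'c::ab_group_add \<Rightarrow> 'c) \<Rightarrow> ('b \<Rightarrow> 'c) \<Rightarrow> bool"
  where
  "linear_on_subspace S s1 s2 f \<longleftrightarrow>
     (\<forall>x\<in>S. \<forall>y\<in>S. f (x + y) = f x + f y) \<and> (\<forall>c. \<forall>x\<in>S. f (s1 c x) = s2 c (f x))"

definition plesken_functional ::
  "('a, 'b) monoid_scheme \<Rightarrow> (('a \<Rightarrow> complex) \<Rightarrow> complex) \<Rightarrow> bool" where
  "plesken_functional G f \<longleftrightarrow> linear_on_subspace (plesken G) ga_scale (*) f"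

definition plesken_bilinear ::
  "('a, 'b) monoid_scheme \<Rightarrow> (('a \<Rightarrow> complex) \<Rightarrow> ('a \<Rightarrow> complex) \<Rightarrow> complex) \<Rightarrow> bool" where
  "plesken_bilinear G \<alpha> \<longleftrightarrow>
     (\<forall>y\<in>plesken G. plesken_functional G (\<lambda>x. \<alpha> x y)) \<and>
     (\<forall>x\<in>plesken G. plesken_functional G (\<lambda>y. \<alpha> x y))"

definition two_cocycle ::
  "('a, 'b) monoid_scheme \<Rightarrow> (('a \<Rightarrow> complex) \<Rightarrow> ('a \<Rightarrow> complex) \<Rightarrow> complex) \<Rightarrow> bool" where
  "two_cocycle G \<alpha> \<longleftrightarrow> plesken_bilinear G \<alpha> \<and>
     (\<forall>x\<in>plesken G. \<forall>y\<in>plesken G. \<forall>z\<in>plesken G.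
        \<alpha> (lie_bracket G x y) z + \<alpha> (lie_bracket G y z) x + \<alpha> (lie_bracket G z x) y = 0)"

definition cohomologous ::
  "('a, 'b) monoid_scheme \<Rightarrow> (('a \<Rightarrow> complex) \<Rightarrow> ('a \<Rightarrow> complex) \<Rightarrow> complex)
     \<Rightarrow> (('a \<Rightarrow> complex) \<Rightarrow> ('a \<Rightarrow> complex) \<Rightarrow> complex) \<Rightarrow> bool" where
  "cohomologous G \<alpha>1 \<alpha>2 \<longleftrightarrow> two_cocycle G \<alpha>1 \<and> two_cocycle G \<alpha>2 \<and>
     (\<exists>\<sigma>. plesken_functional G \<sigma> \<and>
        (\<forall>x\<in>plesken G. \<forall>y\<in>plesken G. \<alpha>2 x y - \<alpha>1 x y = - \<sigma> (lie_bracket G x y)))"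

text \<open>
  The space \<open>V\<close> is the type \<open>'v\<close> with scalar multiplication \<open>s\<close>. Sums and differences of
  endomorphisms are pointwise, and \<open>s c\<close> is the scalar endomorphism \<open>c I\<^sub>V\<close>.
\<close>

definition alpha_representation ::
  "('a, 'b) monoid_scheme \<Rightarrow> (('a \<Rightarrow> complex) \<Rightarrow> ('a \<Rightarrow> complex) \<Rightarrow> complex)
     \<Rightarrow> (complex \<Rightarrow> 'v::ab_group_add \<Rightarrow> 'v) \<Rightarrow> (('a \<Rightarrow> complex) \<Rightarrow> 'v \<Rightarrow> 'v) \<Rightarrow> bool" where
  "alpha_representation G \<alpha> s \<Phi> \<longleftrightarrow>
     (\<exists>B. finite_dimensional_vector_space s B) \<and>
     plesken_bilinear G \<alpha> \<and>
     (\<forall>x\<in>plesken G. Vector_Spaces.linear s s (\<Phi> x)) \<and>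
     linear_on_subspace (plesken G) ga_scale (fun_scale s) \<Phi> \<and>
     (\<forall>x\<in>plesken G. \<forall>y\<in>plesken G.
        (\<Phi> x \<circ> \<Phi> y) - (\<Phi> y \<circ> \<Phi> x) = s (\<alpha> x y) + \<Phi> (lie_bracket G x y))"

definition projectively_equivalent ::
  "('a, 'b) monoid_scheme
     \<Rightarrow> (complex \<Rightarrow> 'v::ab_group_add \<Rightarrow> 'v) \<Rightarrow> (('a \<Rightarrow> complex) \<Rightarrow> 'v \<Rightarrow> 'v)
     \<Rightarrow> (complex \<Rightarrow> 'w::ab_group_add \<Rightarrow> 'w) \<Rightarrow> (('a \<Rightarrow> complex) \<Rightarrow> 'w \<Rightarrow> 'w) \<Rightarrow> bool" where
  "projectively_equivalent G sV \<Phi>1 sW \<Phi>2 \<longleftrightarrow>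
     (\<exists>f \<delta>. Vector_Spaces.linear sV sW f \<and> bij f \<and> plesken_functional G \<delta> \<and>
        (\<forall>x\<in>plesken G. \<Phi>2 x = (f \<circ> \<Phi>1 x \<circ> inv_into UNIV f) + sW (\<delta> x)))"

end

theory Submission imports Defs
begin

text \<open>
  If \<open>\<alpha>2 - \<alpha>1 = - \<sigma> \<circ> [\<cdot>, \<cdot>]\<close>, then \<open>\<Phi>2 = \<Phi>1 + \<sigma> I\<close> on the same space works: the scalar part
  does not affect commutators of endomorphisms, while it contributes \<open>\<sigma> [x, y] I\<close> to \<open>\<Phi>2 [x, y]\<close>,
  which is exactly compensated by passing from \<open>\<alpha>1\<close> to \<open>\<alpha>2\<close>.
\<close>

text \<open>Linearity lets \<open>A\<close> and \<open>B\<close> commute with scalar endomorphisms,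
  and scalars commute with each other, so all terms involving \<open>a\<close> or \<open>b\<close>
  cancel.\<close>

lemma commutator_add_scalars:
  assumes "Vector_Spaces.linear s s A" and "Vector_Spaces.linear s s B"
  shows "((A + s a) \<circ> (B + s b)) - ((B + s b) \<circ> (A + s a)) = (A \<circ> B) - (B \<circ> A)"
proof -
  interpret A: Vector_Spaces.linear s s A by fact
  interpret B: Vector_Spaces.linear s s B by fact
  show ?thesis
    by (simp add: fun_eq_iff A.add A.scale B.add B.scale A.vs1.scale_right_distrib mult.commute)
qed

theorem lemma3p2:
  fixes G :: "('a, 'b) monoid_scheme"
    and \<alpha>1 \<alpha>2 :: "('a \<Rightarrow> complex) \<Rightarrow> ('a \<Rightarrow> complex) \<Rightarrow> complex"
    and sV :: "complex \<Rightarrow> 'v::ab_group_add \<Rightarrow> 'v"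
    and \<Phi>1 :: "('a \<Rightarrow> complex) \<Rightarrow> 'v \<Rightarrow> 'v"
  assumes "group G" and "finite (carrier G)"
    and "alpha_representation G \<alpha>1 sV \<Phi>1"
    and "two_cocycle G \<alpha>2"
    and "cohomologous G \<alpha>1 \<alpha>2"
  shows "\<exists>(sW :: complex \<Rightarrow> 'v \<Rightarrow> 'v) (\<Phi>2 :: ('a \<Rightarrow> complex) \<Rightarrow> 'v \<Rightarrow> 'v).
           alpha_representation G \<alpha>2 sW \<Phi>2 \<and> projectively_equivalent G sV \<Phi>1 sW \<Phi>2"
proof -
  from assms(5) obtain \<sigma> where \<sigma>: "plesken_functional G \<sigma>"
    and diff: "\<And>x y. x \<in> plesken G \<Longrightarrow> y \<in> plesken G \<Longrightarrow>
                 \<alpha>2 x y - \<alpha>1 x y = - \<sigma> (lie_bracket G x y)"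
    unfolding cohomologous_def by blast
  from assms(3) obtain B where fin: "finite_dimensional_vector_space sV B"
    and lin: "\<And>x. x \<in> plesken G \<Longrightarrow> Vector_Spaces.linear sV sV (\<Phi>1 x)"
    and linear_\<Phi>1: "linear_on_subspace (plesken G) ga_scale (fun_scale sV) \<Phi>1"
    and bracket: "\<And>x y. x \<in> plesken G \<Longrightarrow> y \<in> plesken G \<Longrightarrow>
           (\<Phi>1 x \<circ> \<Phi>1 y) - (\<Phi>1 y \<circ> \<Phi>1 x) = sV (\<alpha>1 x y) + \<Phi>1 (lie_bracket G x y)"
    unfolding alpha_representation_def by blast
  interpret V: finite_dimensional_vector_space sV B by fact
  interpret VV: vector_space_pair sV sV ..
  define \<Phi>2 where "\<Phi>2 x = \<Phi>1 x + sV (\<sigma> x)" for x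
  have "Vector_Spaces.linear sV sV (\<Phi>2 x)" if "x \<in> plesken G" for x
    using VV.linear_compose_add[OF lin[OF that] V.linear_scale_self[of "\<sigma> x"]]
    by (simp add: \<Phi>2_def plus_fun_def)
  \<comment> \<open>The added term is \<open>\<sigma>\<close>, linear on \<open>plesken G\<close>,
    followed by the linear map sending \<open>c\<close> to \<open>sV c\<close>.\<close>
  moreover have "linear_on_subspace (plesken G) ga_scale (fun_scale sV) \<Phi>2"
    using linear_\<Phi>1 \<sigma>
    by (simp add: linear_on_subspace_def plesken_functional_def \<Phi>2_def fun_eq_iff fun_scale_def
        V.scale_left_distrib V.scale_right_distrib)
  moreover have "(\<Phi>2 x \<circ> \<Phi>2 y) - (\<Phi>2 y \<circ> \<Phi>2 x) = sV (\<alpha>2 x y) + \<Phi>2 (lie_bracket G x y)"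
    if x: "x \<in> plesken G" and y: "y \<in> plesken G" for x y
  proof -
    \<comment> \<open>The commutators for \<open>\<Phi>2\<close> and \<open>\<Phi>1\<close> agree,
      so only the scalar parts of the two sides are left to compare.\<close>
    have "\<alpha>1 x y = \<alpha>2 x y + \<sigma> (lie_bracket G x y)"
      using diff[OF x y] by (simp add: algebra_simps)
    then show ?thesis
      unfolding \<Phi>2_def commutator_add_scalars[OF lin[OF x] lin[OF y]] bracket[OF x y]
      by (simp add: fun_eq_iff V.scale_left_distrib)
  qed
  \<comment> \<open>The required bilinearity of \<open>\<alpha>2\<close> is part of its being a
    2-cocycle.\<close>
  ultimately have "alpha_representation G \<alpha>2 sV \<Phi>2"
    using fin assms(4) unfolding alpha_representation_def two_cocycle_def by blast
  \<comment> \<open>The space is unchanged, so the isomorphism is \<open>id\<close> and the shift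
    \<open>\<delta>\<close> is \<open>\<sigma>\<close> itself.\<close>
  moreover have "projectively_equivalent G sV \<Phi>1 sV \<Phi>2"
    unfolding projectively_equivalent_def
    using V.linear_id \<sigma> by (intro exI[of _ id] exI[of _ \<sigma>]) (simp add: \<Phi>2_def)
  ultimately show ?thesis by blast
qed

end
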